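(* Let $a>0$ be a real number and let $P\in\mathbb{R}[x]$ be a nonconstant polynomial with only real zeros. Let $\lambda(P)$ and $\Lambda(P)$ be the smallest and the largest zeros of $P$, respectively. Suppose that $P(x)=0$ for all $$x\in \left([\lambda(P),-a]\cap\{-a,-a-1,-a-2,\ldots\}\right)\cup\left([0,\Lambda(P)]\cap\mathbb{Z}\right).$$ Then the polynomial $\mathcal{L}_a(P)$ has only real zeros, and they all lie in the segment $[-1,0]$.
   Context: For real $a>0$, $(a)_0=1$ and $(a)_k=a(a+1)\cdots(a+k-1)$ for $k\ge 1$ is the Pochhammer symbol. The linear operator $\mathcal{L}_a:\mathbb{R}[x]\to\mathbb{R}[x]$ is defined on the basis $\frac{x(x-1)\cdots(x-k+1)}{(a)_k}$, $k=0,1,2,\ldots$ (the element for $k=0$ being $1$), by $$\mathcal{L}_a\left(\frac{x(x-1)\cdots(x-k+1)}{(a)_k}\right)=x^k,$$ that is, $\mathcal{L}_a\left(\sum_{k=0}^n a_k\frac{x(x-1)\cdots(x-k+1)}{(a)_k}\right)=\sum_{k=0}^n a_kx^k$. An interval $[u,v]$ with $u>v$ is understood to be empty. "Has only real zeros lying in $[-1,0]$" means that every complex zero is real and belongs to $[-1,0]$. *)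

theory Defs
  imports "HOL-Computational_Algebra.Computational_Algebra"
begin

definition complex_zeros :: "real poly \<Rightarrow> complex set" where
  "complex_zeros P = {z. poly (map_poly complex_of_real P) z = 0}"

definition only_real_zeros :: "real poly \<Rightarrow> bool" where
  "only_real_zeros P \<longleftrightarrow> complex_zeros P \<subseteq> \<real>"

(* Min and Max are meaningful here only for a nonzero P with at least one real zero. *)
definition smallest_zero :: "real poly \<Rightarrow> real" where
  "smallest_zero P = Min {x. poly P x = 0}"

definition largest_zero :: "real poly \<Rightarrow> real" where
  "largest_zero P = Max {x. poly P x = 0}"

(* x (x - 1) ... (x - k + 1) *)
definition falling_poly :: "nat \<Rightarrow> real poly" where
  "falling_poly k = (\<Prod>i<k. [:- real i, 1:])"

definition newton_basis :: "real \<Rightarrow> nat \<Rightarrow> real poly" where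
  "newton_basis a k = smult (inverse (pochhammer a k)) (falling_poly k)"

definition is_basis_map :: "real \<Rightarrow> (real poly \<Rightarrow> real poly) \<Rightarrow> bool" where
  "is_basis_map a L \<longleftrightarrow>
     Vector_Spaces.linear smult smult L \<and> (\<forall>k. L (newton_basis a k) = monom 1 k)"

(* For a > 0 the description is proper: see ex1_is_basis_map below. *)
definition L_op :: "real \<Rightarrow> real poly \<Rightarrow> real poly" where
  "L_op a = (THE L. is_basis_map a L)"

lemma vector_space_smult: "vector_space (smult :: real \<Rightarrow> real poly \<Rightarrow> real poly)"
  by unfold_locales (auto simp: smult_add_right smult_add_left)

lemma linear_smult_iff:
  "Vector_Spaces.linear smult smult (L :: real poly \<Rightarrow> real poly) \<longleftrightarrow>
     (\<forall>p q. L (p + q) = L p + L q) \<and> (\<forall>c p. L (smult c p) = smult c (L p))"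
  using vector_space_smult
  by (auto simp: Vector_Spaces.linear_def module_hom_def module_hom_axioms_def
      vector_space_def module_def)

lemma falling_poly_0 [simp]: "falling_poly 0 = 1"
  by (simp add: falling_poly_def)

lemma falling_poly_Suc: "falling_poly (Suc k) = [:- real k, 1:] * falling_poly k"
  by (simp add: falling_poly_def mult.commute)

(* In terms of M, where M sends falling_poly k to (a)_k x^k, multiplication by x becomes
   Q \<mapsto> x (a Q + (x + 1) Q'). *)
definition shift_step :: "real \<Rightarrow> real poly \<Rightarrow> real poly" where
  "shift_step a Q = pCons 0 (smult a Q + [:1, 1:] * pderiv Q)"

definition basis_map_witness :: "real \<Rightarrow> real poly \<Rightarrow> real poly" where
  "basis_map_witness a P = fold_coeffs (\<lambda>c Q. [:c:] + shift_step a Q) P 0"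

lemma shift_step_0 [simp]: "shift_step a 0 = 0"
  by (simp add: shift_step_def)

lemma shift_step_add: "shift_step a (p + q) = shift_step a p + shift_step a q"
  by (simp add: shift_step_def pderiv_add smult_add_right algebra_simps)

lemma shift_step_smult: "shift_step a (smult c p) = smult c (shift_step a p)"
  by (simp add: shift_step_def pderiv_smult smult_add_right algebra_simps)

lemma witness_0 [simp]: "basis_map_witness a 0 = 0"
  by (simp add: basis_map_witness_def)

lemma witness_pCons:
  "basis_map_witness a (pCons c p) = [:c:] + shift_step a (basis_map_witness a p)"
  by (cases "c = 0 \<and> p = 0") (auto simp: basis_map_witness_def)

lemma witness_add:
  "basis_map_witness a (p + q) = basis_map_witness a p + basis_map_witness a q"
proof (induction p arbitrary: q)
  case (pCons c p)
  show ?case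
    by (cases q) (simp add: witness_pCons pCons.IH shift_step_add)
qed simp

lemma witness_smult: "basis_map_witness a (smult c p) = smult c (basis_map_witness a p)"
  by (induction p) (simp_all add: witness_pCons shift_step_smult smult_add_right)

lemma shift_step_monom:
  "shift_step a (monom c k) = monom ((a + real k) * c) (Suc k) + monom (real k * c) k"
proof (cases k)
  case 0
  then show ?thesis
    by (simp add: shift_step_def pderiv_monom smult_monom monom_Suc)
next
  case (Suc n)
  have "[:1, 1:] * monom d n = monom d n + monom d (Suc n)" for d :: real
    by (simp add: monom_Suc)
  then have "shift_step a (monom c k) =
      pCons 0 (monom (a * c) k + (monom (real k * c) n + monom (real k * c) k))"
    by (simp only: shift_step_def pderiv_monom smult_monom Suc) simp
  also have "\<dots> = pCons 0 (monom ((a + real k) * c) k) + pCons 0 (monom (real k * c) n)"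
    by (simp add: distrib_right flip: add_monom)
  finally show ?thesis
    by (simp only: Suc flip: monom_Suc)
qed

lemma witness_falling_poly:
  "basis_map_witness a (falling_poly k) = monom (pochhammer a k) k"
proof (induction k)
  case 0
  have "basis_map_witness a [:1:] = [:1:]"
    by (simp add: witness_pCons)
  then show ?case
    by (simp add: one_pCons monom_0)
next
  case (Suc k)
  have "falling_poly (Suc k) = pCons 0 (falling_poly k) + smult (- real k) (falling_poly k)"
    by (simp add: falling_poly_Suc)
  then have "basis_map_witness a (falling_poly (Suc k)) =
      shift_step a (monom (pochhammer a k) k) + smult (- real k) (monom (pochhammer a k) k)"
    by (simp only: witness_add witness_smult witness_pCons Suc.IH) simp
  then show ?case
    by (simp add: shift_step_monom pochhammer_Suc smult_monom add_monom mult.commute)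
qed

lemma is_basis_map_witness:
  assumes "a > 0"
  shows "is_basis_map a (basis_map_witness a)"
  using pochhammer_pos[OF assms]
  by (auto simp: is_basis_map_def linear_smult_iff witness_add witness_smult newton_basis_def
      witness_falling_poly smult_monom less_imp_neq[symmetric])

lemma is_basis_map_unique:
  assumes a: "a > 0" and "is_basis_map a L" "is_basis_map a L'"
  shows "L = L'"
proof
  have add: "L (p + q) = L p + L q" "L' (p + q) = L' p + L' q"
    and sm: "L (smult c p) = smult c (L p)" "L' (smult c p) = smult c (L' p)" for p q c
    using assms by (auto simp: is_basis_map_def linear_smult_iff)
  have "falling_poly k = smult (pochhammer a k) (newton_basis a k)" for k
    using pochhammer_pos[OF a, of k] by (simp add: newton_basis_def)
  then have fall: "L (falling_poly k) = L' (falling_poly k)" for k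
    using assms(2,3) by (simp add: sm is_basis_map_def)
  have mon: "L (monom 1 n * falling_poly k) = L' (monom 1 n * falling_poly k)" for n k
  proof (induction n arbitrary: k)
    case 0
    then show ?case by (simp add: fall)
  next
    case (Suc n)
    have "monom 1 (Suc n) * falling_poly k =
        monom 1 n * falling_poly (Suc k) + smult (real k) (monom 1 n * falling_poly k)"
      by (simp add: falling_poly_Suc monom_Suc algebra_simps)
    then show ?case
      by (simp only: add sm Suc.IH)
  qed
  have gen: "L (monom 1 n * p) = L' (monom 1 n * p)" for n p
  proof (induction p arbitrary: n)
    case 0
    show ?case using sm[of 0 0] by simp
  next
    case (pCons c p)
    have "monom 1 n * pCons c p = smult c (monom 1 n * falling_poly 0) + monom 1 (Suc n) * p"
      by (simp add: monom_Suc)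
    then show ?case
      by (simp only: add sm mon pCons.IH)
  qed
  show "L p = L' p" for p
    using gen[of 0 p] by simp
qed

lemma ex1_is_basis_map:
  assumes "a > 0"
  shows "\<exists>!L. is_basis_map a L"
  using is_basis_map_witness[OF assms] is_basis_map_unique[OF assms] by blast

lemma is_basis_map_L_op:
  assumes "a > 0"
  shows "is_basis_map a (L_op a)"
  unfolding L_op_def using ex1_is_basis_map[OF assms] by (rule theI')

end

theory Submission
  imports Defs
begin

text \<open>
  Write \<open>M\<^sub>a\<close> for \<open>basis_map_witness a\<close>, which is the explicit form of \<open>L_op a\<close>: it sends
  \<open>x(x-1)\<cdots>(x-k+1)\<close> to \<open>(a)\<^sub>k x\<^sup>k\<close>. Two ideas give the theorem.

  If all zeros of \<open>P\<close> lie in \<open>[-a,0]\<close>, one builds \<open>P\<close> up one linear factor at a time. With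
  \<open>Q = M\<^sub>a R\<close>, multiplying \<open>R\<close> by \<open>x + b\<close> replaces \<open>Q\<close> by \<open>(a x + b) Q + x (1 + x) Q'\<close>. Divided by
  \<open>x (1 + x) Q\<close> this is \<open>b/x + (a-b)/(1+x) + \<Sum> 1/(x-q)\<close>, the sum being over the zeros \<open>q\<close> of \<open>Q\<close>.
  For \<open>0 \<le> b \<le> a\<close> all weights are nonnegative, so the argument of the Gauss-Lucas theorem confines
  the new zeros to the convex hull of \<open>-1\<close>, \<open>0\<close> and the old zeros, that is to \<open>[-1,0]\<close>
  (\<open>zeros_multiplication_step\<close>).

  Zeros outside \<open>(-a,0)\<close> are pulled in by raising the parameter. The identities
  \<open>M\<^sub>a((x+a) p) = a (1+x) M\<^bsub>a+1\<^esub> p\<close> and \<open>M\<^sub>a(x p(x-1)) = a x M\<^bsub>a+1\<^esub> p\<close> remove a zero \<open>-a\<close> or \<open>0\<close> at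
  the cost of a zero \<open>-1\<close> or \<open>0\<close> of the image. The hypothesis on \<open>P\<close> keeps this going: it makes
  \<open>0\<close> a zero as soon as some zero is nonnegative and \<open>-a\<close> a zero as soon as some zero is at
  most \<open>-a\<close>, and it holds again for \<open>p\<close> and \<open>a + 1\<close>. When neither \<open>0\<close> nor \<open>-a\<close> is a zero any
  more, all the remaining zeros lie in \<open>(-a,0)\<close>
  (\<open>zeros_witness_root_poly\<close>).
\<close>

section \<open>Evaluation of real polynomials at complex points\<close>

abbreviation ceval :: "real poly \<Rightarrow> complex \<Rightarrow> complex" where
  "ceval p \<equiv> poly (map_poly complex_of_real p)"

lemma ceval_pCons: "ceval (pCons c p) z = complex_of_real c + z * ceval p z"
  by (simp add: map_poly_pCons)

lemma ceval_add: "ceval (p + q) z = ceval p z + ceval q z"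
  by (induction p q rule: poly_induct2) (simp_all add: ceval_pCons algebra_simps)

lemma ceval_smult: "ceval (smult c p) z = complex_of_real c * ceval p z"
  by (induction p) (simp_all add: ceval_pCons algebra_simps)

lemma ceval_mult: "ceval (p * q) z = ceval p z * ceval q z"
  by (induction p) (simp_all add: ceval_pCons ceval_add ceval_smult algebra_simps)

lemmas ceval_simps = ceval_pCons ceval_add ceval_smult ceval_mult

lemma mem_complex_zeros: "z \<in> complex_zeros p \<longleftrightarrow> ceval p z = 0"
  by (simp add: complex_zeros_def)

lemma complex_zeros_mult: "complex_zeros (p * q) = complex_zeros p \<union> complex_zeros q"
  by (auto simp: mem_complex_zeros ceval_mult)

lemma complex_zeros_smult: "c \<noteq> 0 \<Longrightarrow> complex_zeros (smult c p) = complex_zeros p"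
  by (auto simp: mem_complex_zeros ceval_smult)

lemma complex_zeros_linear: "complex_zeros [:- r, 1:] = {complex_of_real r}"
  by (auto simp: mem_complex_zeros ceval_pCons)

section \<open>Real-rooted polynomials as products of linear factors\<close>

definition root_poly :: "real list \<Rightarrow> real poly" where
  "root_poly rs = (\<Prod>r\<leftarrow>rs. [:- r, 1:])"

lemma root_poly_Nil [simp]: "root_poly [] = 1"
  by (simp add: root_poly_def)

lemma root_poly_Cons [simp]: "root_poly (r # rs) = [:- r, 1:] * root_poly rs"
  by (simp add: root_poly_def)

lemma root_poly_remove1:
  "r \<in> set rs \<Longrightarrow> root_poly rs = [:- r, 1:] * root_poly (remove1 r rs)"
  by (induction rs) (auto simp: algebra_simps simp del: mult_pCons_left mult_pCons_right)

lemma poly_root_poly_eq_0_iff: "poly (root_poly rs) x = 0 \<longleftrightarrow> x \<in> set rs"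
  by (induction rs) auto

lemma complex_zeros_root_poly: "complex_zeros (root_poly rs) = complex_of_real ` set rs"
proof (induction rs)
  case Nil
  show ?case
    by (auto simp: mem_complex_zeros)
next
  case (Cons r rs)
  then show ?case
    by (simp only: root_poly_Cons complex_zeros_mult complex_zeros_linear) simp
qed

lemma pcompose_root_poly_shift:
  "pcompose (root_poly (map (\<lambda>r. r - 1) rs)) [:-1, 1:] = root_poly rs"
proof (induction rs)
  case Nil
  show ?case
    by (simp add: pcompose_1)
next
  case (Cons r rs)
  have "pcompose [:- (r - 1), 1:] [:-1, 1:] = [:- r, 1:]"
    by (simp add: pcompose_pCons)
  then show ?case
    by (simp only: list.map root_poly_Cons pcompose_mult Cons.IH)
qed

lemma only_real_zeros_imp_root_poly:
  assumes "P \<noteq> 0" "complex_zeros P \<subseteq> \<real>"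
  obtains c rs where "c \<noteq> 0" "P = smult c (root_poly rs)"
  using assms
proof (induction "degree P" arbitrary: P thesis)
  case 0
  then obtain c where "P = [:c:]"
    by (metis degree_eq_zeroE)
  with 0 show ?case
    by (intro "0.prems"(1)[of c "[]"]) auto
next
  case (Suc n)
  have "\<not> constant (poly (map_poly complex_of_real P))"
    by (metis Suc.hyps(2) constant_degree degree_map_poly nat.distinct(1) of_real_eq_0_iff)
  then obtain z where z: "ceval P z = 0"
    using fundamental_theorem_of_algebra by blast
  then obtain r where r: "z = complex_of_real r"
    using Suc.prems(3) by (auto simp: complex_zeros_def Reals_def)
  have "ceval P (complex_of_real r) = complex_of_real (poly P r)"
    by (induction P) (simp_all add: ceval_pCons)
  then have "[:- r, 1:] dvd P"
    using z r by (simp add: poly_eq_0_iff_dvd)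
  then obtain R where R: "P = [:- r, 1:] * R"
    by (elim dvdE)
  with Suc.prems have "R \<noteq> 0"
    by auto
  with R Suc.hyps(2) have "n = degree R"
    by (simp add: degree_mult_eq del: mult_pCons_left)
  moreover have "complex_zeros R \<subseteq> \<real>"
    using Suc.prems(3) unfolding R complex_zeros_mult by simp
  ultimately obtain c rs where "c \<noteq> 0" "R = smult c (root_poly rs)"
    using Suc.hyps(1) \<open>R \<noteq> 0\<close> by blast
  moreover from this have "P = smult c (root_poly (r # rs))"
    by (simp only: R root_poly_Cons mult_smult_right)
  ultimately show ?case
    by (intro Suc.prems(1))
qed

lemma ceval_pderiv_root_poly:
  assumes "z \<notin> complex_of_real ` set rs"
  shows "ceval (pderiv (root_poly rs)) z =
    (\<Sum>r\<leftarrow>rs. 1 / (z - complex_of_real r)) * ceval (root_poly rs) z"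
  using assms
proof (induction rs)
  case Nil
  then show ?case by simp
next
  case (Cons r rs)
  then have "z - complex_of_real r \<noteq> 0"
    by auto
  moreover have "pderiv [:- r, 1:] = 1"
    by (simp add: pderiv_pCons)
  ultimately show ?case
    using Cons
    by (simp add: pderiv_mult ceval_simps field_simps del: mult_pCons_left mult_pCons_right)
qed

section \<open>Adjoining a zero in $[-a,0]$\<close>

text \<open>
  The values of \<open>Q'/Q\<close> off the zeros of \<open>Q\<close> are sums of reciprocals \<open>1/(z-p)\<close>. A point outside the segment is separated from it by a line: all the vectors \<open>z - p\<close>, and hence
  all their reciprocals, lie in a common open half-plane.
\<close>

lemma reciprocals_in_half_plane:
  assumes "z \<notin> complex_of_real ` {-1..0}"
  obtains u where "\<And>p. p \<in> {-1..0} \<Longrightarrow> Re (u * (1 / (z - complex_of_real p))) > 0"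
proof (cases "Im z = 0")
  case True
  then have z: "z = complex_of_real (Re z)"
    by (simp add: complex_eq_iff)
  then have "Re z > 0 \<or> Re z < -1"
    using assms by (metis atLeastAtMost_iff image_eqI not_le)
  moreover have "Re (of_real s * (1 / (z - complex_of_real p))) = s / (Re z - p)" for s p
    by (subst z) (simp flip: of_real_diff of_real_divide of_real_mult)
  ultimately show ?thesis
    using that[of "of_real (if Re z > 0 then 1 else -1)"]
    by (auto simp: zero_less_divide_iff)
next
  case False
  have "Re (\<i> * of_real (Im z) * (1 / (z - complex_of_real p))) =
      (Im z)\<^sup>2 / ((Re z - p)\<^sup>2 + (Im z)\<^sup>2)" for p
    by (simp add: Re_divide Im_divide power2_eq_square)
  moreover have "(Im z)\<^sup>2 / ((Re z - p)\<^sup>2 + (Im z)\<^sup>2) > 0" for p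
    using False by (intro divide_pos_pos add_nonneg_pos) auto
  ultimately show ?thesis
    using that[of "\<i> * of_real (Im z)"] by presburger
qed

text \<open>
  If \<open>Q\<close> is the image of \<open>R\<close>, the polynomial considered here is the image of \<open>(x + b) R\<close>. At a zero
  \<open>z\<close> off the segment, division by \<open>z (1 + z) Q(z)\<close> would leave a vanishing combination of the
  numbers \<open>1/(z-p)\<close>, \<open>-1 \<le> p \<le> 0\<close>, with nonnegative weights that are not all zero. This is
  impossible in an open half-plane.
\<close>

lemma zeros_multiplication_step:
  assumes "complex_zeros Q \<subseteq> complex_of_real ` {-1..0}" "a > 0" "0 \<le> b" "b \<le> a"
  shows "complex_zeros (shift_step a Q + smult b Q) \<subseteq> complex_of_real ` {-1..0}"
proof
  fix z assume zero: "z \<in> complex_zeros (shift_step a Q + smult b Q)"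
  show "z \<in> complex_of_real ` {-1..0}"
  proof (rule ccontr)
    assume z: "z \<notin> complex_of_real ` {-1..0}"
    then obtain u where
      u: "\<And>p. p \<in> {-1..0} \<Longrightarrow> Re (u * (1 / (z - complex_of_real p))) > 0"
      using reciprocals_in_half_plane by blast
    have Qz: "ceval Q z \<noteq> 0"
      using z assms(1) by (auto simp: mem_complex_zeros)
    then have "Q \<noteq> 0"
      by auto
    moreover have "complex_zeros Q \<subseteq> \<real>"
      using assms(1) by auto
    ultimately obtain c rs where c: "c \<noteq> 0" and Q: "Q = smult c (root_poly rs)"
      using only_real_zeros_imp_root_poly by blast
    have rs: "set rs \<subseteq> {-1..0}"
      using assms(1) c unfolding Q
      by (auto simp: complex_zeros_smult complex_zeros_root_poly)
    define w where "w = (\<Sum>r\<leftarrow>rs. 1 / (z - complex_of_real r))"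
    have dQ: "ceval (pderiv Q) z = w * ceval Q z"
      using z rs
      by (subst (1 2) Q, subst pderiv_smult, unfold ceval_smult, subst ceval_pderiv_root_poly)
        (auto simp: w_def)
    have w: "Re (u * w) \<ge> 0"
      unfolding w_def using rs
    proof (induction rs)
      case (Cons r rs)
      then show ?case
        using u[of r] by (simp add: distrib_left)
    qed simp
    have z0: "z \<noteq> 0" "1 + z \<noteq> 0"
      using z by (force, metis add_eq_0_iff atLeastAtMost_iff image_eqI of_real_1 of_real_minus
          order_refl zero_le_one neg_le_0_iff_le)
    have "0 = ceval Q z * (of_real a * z + of_real b + z * (1 + z) * w)"
      using zero
      by (simp add: mem_complex_zeros shift_step_def ceval_simps dQ algebra_simps
          del: mult_pCons_left)
    also have "of_real a * z + of_real b + z * (1 + z) * w =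
        z * (1 + z) * (of_real b * (1 / z) + of_real (a - b) * (1 / (1 + z)) + w)"
    proof -
      have "z * (1 / z) = 1" "(1 + z) * (1 / (1 + z)) = 1"
        using z0 by simp_all
      then show ?thesis
        unfolding of_real_diff by algebra
    qed
    finally have "of_real b * (1 / z) + of_real (a - b) * (1 / (1 + z)) + w = 0"
      using Qz z0 by auto
    then have "Re (u * (of_real b * (1 / z) + of_real (a - b) * (1 / (1 + z)) + w)) = 0"
      by simp
    also have "u * (of_real b * (1 / z) + of_real (a - b) * (1 / (1 + z)) + w) =
        of_real b * (u * (1 / z)) + of_real (a - b) * (u * (1 / (1 + z))) + u * w"
      by (simp add: algebra_simps)
    finally have sum: "b * Re (u * (1 / z)) + (a - b) * Re (u * (1 / (1 + z))) + Re (u * w) = 0"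
      by (simp only: plus_complex.sel Re_complex_of_real times_complex.sel Im_complex_of_real)
    have pos: "Re (u * (1 / z)) > 0" "Re (u * (1 / (1 + z))) > 0"
      using u[of 0] u[of "-1"] by (simp_all add: add.commute)
    \<comment> \<open>The two weights add up to \<open>a > 0\<close>, so at least one of the first two terms is positive.\<close>
    have "b * Re (u * (1 / z)) + (a - b) * Re (u * (1 / (1 + z))) > 0"
    proof (cases "b = 0")
      case True
      then show ?thesis
        using pos assms by simp
    next
      case False
      then show ?thesis
        using pos assms by (intro add_pos_nonneg mult_pos_pos mult_nonneg_nonneg) auto
    qed
    with sum w show False
      by linarith
  qed
qed

lemma witness_linear_factor:
  "basis_map_witness a ([:- r, 1:] * p) =
     shift_step a (basis_map_witness a p) + smult (- r) (basis_map_witness a p)"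
proof -
  have "[:- r, 1:] * p = pCons 0 p + smult (- r) p"
    by simp
  then show ?thesis
    by (simp only: witness_add witness_smult witness_pCons) simp
qed

lemma witness_1 [simp]: "basis_map_witness a 1 = 1"
  by (simp add: one_pCons witness_pCons)

lemma zeros_witness_root_poly_bounded:
  assumes "a > 0" "set rs \<subseteq> {- a..0}"
  shows "complex_zeros (basis_map_witness a (root_poly rs)) \<subseteq> complex_of_real ` {-1..0}"
  using assms(2)
proof (induction rs)
  case Nil
  show ?case
    by (auto simp: mem_complex_zeros)
next
  case (Cons r rs)
  then show ?case
    using assms(1)
    by (simp only: root_poly_Cons witness_linear_factor) (rule zeros_multiplication_step, auto)
qed

section \<open>Removing the zeros $-a$ and $0$\<close>

lemma shift_step_conv:
  "shift_step a Q = [:0, 1:] * ([:a:] * Q + (1 + [:0, 1:]) * pderiv Q)"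
  by (simp add: shift_step_def one_pCons)

lemma pderiv_X: "pderiv [:0, 1:] = 1" and pderiv_C: "pderiv [:c:] = 0"
  by (simp_all add: pderiv_pCons)

lemmas X_simps = shift_step_conv pderiv_mult pderiv_add pderiv_diff pderiv_X pderiv_C pderiv_1

lemmas ring_simps = algebra_simps mult_1_left mult_1_right mult_zero_left mult_zero_right
  add_0_left add_0_right

text \<open>
  The ratio \<open>(a + 1)\<^sub>k / (a)\<^sub>k = (a + k) / a\<close> is the eigenvalue at \<open>x\<^sup>k\<close> of the
  operator \<open>1 + (x/a) d/dx\<close>.
\<close>

lemma witness_plus_1:
  "smult a (basis_map_witness (a + 1) p) =
     smult a (basis_map_witness a p) + pCons 0 (pderiv (basis_map_witness a p))"
proof (induction p)
  case (pCons c p)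
  define X :: "real poly" where "X = [:0, 1:]"
  define Q where "Q = basis_map_witness a p"
  have "smult a (basis_map_witness (a + 1) (pCons c p)) =
      smult a [:c:] + shift_step (a + 1) (smult a (basis_map_witness (a + 1) p))"
    by (simp only: witness_pCons smult_add_right shift_step_smult)
  also have "smult a (basis_map_witness (a + 1) p) = [:a:] * Q + X * pderiv Q"
    unfolding pCons.IH by (simp add: Q_def X_def)
  also have "smult a [:c:] + shift_step (a + 1) ([:a:] * Q + X * pderiv Q) =
      [:a:] * ([:c:] + shift_step a Q) + X * pderiv ([:c:] + shift_step a Q)"
  proof -
    have "[:a + 1:] = [:a:] + 1" "smult a [:c:] = [:a:] * [:c:]"
      by (simp_all add: one_pCons)
    then show ?thesis
      unfolding X_def by (simp only: X_simps) (simp only: ring_simps)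
  qed
  also have "\<dots> = smult a (basis_map_witness a (pCons c p)) +
      pCons 0 (pderiv (basis_map_witness a (pCons c p)))"
    by (simp add: witness_pCons Q_def X_def)
  finally show ?case .
qed simp

text \<open>
  On the side of the image, multiplication by \<open>x + a\<close> is \<open>Q \<mapsto> x (a Q + (1 + x) Q') + a Q\<close>, which
  factors as \<open>(1 + x) (a Q + x Q')\<close>; the second factor is the change of the parameter.
\<close>

lemma witness_factor_minus_a:
  "basis_map_witness a ([:a, 1:] * p) = smult a ([:1, 1:] * basis_map_witness (a + 1) p)"
proof -
  define Q where "Q = basis_map_witness a p"
  have "basis_map_witness a ([:a, 1:] * p) = shift_step a Q + smult a Q"
    using witness_linear_factor[of a "- a" p] by (simp add: Q_def)
  also have "\<dots> = [:1, 1:] * (smult a Q + pCons 0 (pderiv Q))"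
  proof -
    have eqs: "[:1, 1:] = 1 + [:0, 1 :: real:]" "smult a Q = [:a:] * Q"
      "pCons 0 (pderiv Q) = [:0, 1:] * pderiv Q"
      by (simp_all add: one_pCons)
    show ?thesis
      unfolding shift_step_conv eqs by (simp only: ring_simps)
  qed
  also have "\<dots> = [:1, 1:] * smult a (basis_map_witness (a + 1) p)"
    by (simp only: witness_plus_1 Q_def)
  finally show ?thesis
    by (simp only: mult_smult_right)
qed

text \<open>
  The mirror image of \<open>witness_plus_1\<close>: the substitution \<open>x \<mapsto> -a - x\<close> on the side of
  \<open>P\<close> corresponds to \<open>x \<mapsto> -1 - x\<close> on the side of the image, which turns \<open>x d/dx\<close> into
  \<open>(1 + x) d/dx\<close> and accounts for the shift of the argument.
\<close>

lemma witness_plus_1_shifted: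
  "smult a (basis_map_witness (a + 1) p) =
     smult a (basis_map_witness a (pcompose p [:-1, 1:])) +
     [:1, 1:] * pderiv (basis_map_witness a (pcompose p [:-1, 1:]))"
proof (induction p)
  case (pCons c p)
  define X :: "real poly" where "X = [:0, 1:]"
  define V where "V = basis_map_witness a (pcompose p [:-1, 1:])"
  have eq: "basis_map_witness a (pcompose (pCons c p) [:-1, 1:]) =
      [:c:] + (shift_step a V - V)"
    using witness_linear_factor[of a 1 "pcompose p [:-1, 1:]"]
    by (simp only: pcompose_pCons witness_add V_def)
      (simp add: witness_pCons)
  have "smult a (basis_map_witness (a + 1) (pCons c p)) =
      smult a [:c:] + shift_step (a + 1) (smult a (basis_map_witness (a + 1) p))"
    by (simp only: witness_pCons smult_add_right shift_step_smult)
  also have "smult a (basis_map_witness (a + 1) p) = [:a:] * V + (1 + X) * pderiv V"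
    unfolding pCons.IH by (simp add: V_def X_def one_pCons)
  also have "smult a [:c:] + shift_step (a + 1) ([:a:] * V + (1 + X) * pderiv V) =
      [:a:] * ([:c:] + (shift_step a V - V)) +
      (1 + X) * pderiv ([:c:] + (shift_step a V - V))"
  proof -
    have "[:a + 1:] = [:a:] + 1" "smult a [:c:] = [:a:] * [:c:]"
      by (simp_all add: one_pCons)
    then show ?thesis
      unfolding X_def by (simp only: X_simps) (simp only: ring_simps)
  qed
  also have "\<dots> = smult a (basis_map_witness a (pcompose (pCons c p) [:-1, 1:])) +
      [:1, 1:] * pderiv (basis_map_witness a (pcompose (pCons c p) [:-1, 1:]))"
    unfolding eq by (simp add: X_def one_pCons)
  finally show ?case .
qed simp

lemma witness_factor_0:
  "basis_map_witness a ([:0, 1:] * pcompose p [:-1, 1:]) =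
     smult a ([:0, 1:] * basis_map_witness (a + 1) p)"
proof -
  have "basis_map_witness a ([:0, 1:] * pcompose p [:-1, 1:]) =
      [:0, 1:] * smult a (basis_map_witness (a + 1) p)"
    by (simp add: witness_pCons witness_plus_1_shifted shift_step_def)
  then show ?thesis
    by (simp only: mult_smult_right)
qed

section \<open>Induction on the number of zeros\<close>

text \<open>
  The hypothesis is phrased for each zero \<open>r\<close> separately, without the extreme zeros, because in
  this form it passes to the smaller list of zeros in both removal steps.
\<close>

lemma zeros_witness_root_poly:
  assumes "a > 0"
    and "\<And>r k. r \<in> set rs \<Longrightarrow> real k \<le> r \<Longrightarrow> real k \<in> set rs"
    and "\<And>r k. r \<in> set rs \<Longrightarrow> r \<le> - a - real k \<Longrightarrow> - a - real k \<in> set rs"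
  shows "complex_zeros (basis_map_witness a (root_poly rs)) \<subseteq> complex_of_real ` {-1..0}"
  using assms
proof (induction "length rs" arbitrary: a rs rule: less_induct)
  case less
  note up = less.prems(2) and down = less.prems(3)
  consider "0 \<in> set rs" | "- a \<in> set rs" | "0 \<notin> set rs" "- a \<notin> set rs"
    by blast
  then show ?case
  proof cases
    case 1
    define ts where "ts = remove1 0 rs"
    \<comment> \<open>Translation by \<open>-1\<close> sends \<open>k + 1\<close> to \<open>k\<close> and \<open>- a - k\<close> to \<open>- (a + 1) - k\<close>, so the hypothesis
      at \<open>Suc k\<close>, respectively \<open>k\<close>, becomes the one for the parameter \<open>a + 1\<close> at \<open>k\<close>.\<close>
    define qs where "qs = map (\<lambda>r. r - 1) ts"
    have mem: "x \<in> set qs \<longleftrightarrow> x + 1 \<in> set ts" for x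
      by (force simp: qs_def)
    have ts: "x \<in> set ts" if "x \<in> set rs" "x \<noteq> 0" for x
      using that by (simp add: ts_def)
    have sub: "set ts \<subseteq> set rs"
      by (simp add: ts_def set_remove1_subset)
    have IH: "complex_zeros (basis_map_witness (a + 1) (root_poly qs)) \<subseteq>
        complex_of_real ` {-1..0}"
    proof (rule less.hyps)
      show "length qs < length rs"
        using 1 length_pos_if_in_set[OF 1] by (simp add: qs_def ts_def length_remove1)
      show "a + 1 > 0"
        using less.prems(1) by simp
    next
      fix r k assume "r \<in> set qs" "real k \<le> r"
      then have "real (Suc k) \<in> set rs"
        using sub by (intro up[of "r + 1"]) (auto simp: mem)
      then show "real k \<in> set qs"
        using ts[of "real (Suc k)"] by (simp add: mem add.commute)
    next
      fix r k assume "r \<in> set qs" "r \<le> - (a + 1) - real k"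
      then have "- a - real k \<in> set rs"
        using sub by (intro down[of "r + 1"]) (auto simp: mem)
      then show "- (a + 1) - real k \<in> set qs"
        using ts[of "- a - real k"] less.prems(1) by (simp add: mem)
    qed
    have "root_poly rs = [:0, 1:] * pcompose (root_poly qs) [:-1, 1:]"
      using root_poly_remove1[OF 1] by (simp add: qs_def ts_def pcompose_root_poly_shift)
    then show ?thesis
      using IH complex_zeros_linear[of 0] less.prems(1)
      by (simp only: witness_factor_0)
        (auto simp: complex_zeros_smult complex_zeros_mult
          simp del: mult_pCons_left)
  next
    case 2
    \<comment> \<open>Here the zeros stay in place, and it is the lower condition that is used at \<open>Suc k\<close>.\<close>
    define ts where "ts = remove1 (- a) rs"
    have ts: "x \<in> set ts" if "x \<in> set rs" "x \<noteq> - a" for x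
      using that by (simp add: ts_def)
    have sub: "set ts \<subseteq> set rs"
      by (simp add: ts_def set_remove1_subset)
    have IH: "complex_zeros (basis_map_witness (a + 1) (root_poly ts)) \<subseteq>
        complex_of_real ` {-1..0}"
    proof (rule less.hyps)
      show "length ts < length rs"
        using 2 length_pos_if_in_set[OF 2] by (simp add: ts_def length_remove1)
      show "a + 1 > 0"
        using less.prems(1) by simp
    next
      fix r k assume "r \<in> set ts" "real k \<le> r"
      then have "real k \<in> set rs"
        using sub up by blast
      then show "real k \<in> set ts"
        using ts[of "real k"] less.prems(1) by simp
    next
      fix r k assume "r \<in> set ts" "r \<le> - (a + 1) - real k"
      then have "- a - real (Suc k) \<in> set rs"
        using sub by (intro down[of r]) auto
      then have "- a - real (Suc k) \<in> set ts"
        by (rule ts) simp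
      also have "- a - real (Suc k) = - (a + 1) - real k"
        by simp
      finally show "- (a + 1) - real k \<in> set ts" .
    qed
    have "root_poly rs = [:a, 1:] * root_poly ts"
      using root_poly_remove1[OF 2] by (simp add: ts_def)
    moreover have "- 1 \<in> complex_of_real ` {-1..0}"
      by (rule image_eqI[of _ _ "-1"]) simp_all
    ultimately show ?thesis
      using IH complex_zeros_linear[of "-1"] less.prems(1)
      by (simp only: witness_factor_minus_a)
        (auto simp: complex_zeros_smult complex_zeros_mult
          simp del: mult_pCons_left)
  next
    case 3
    then have "set rs \<subseteq> {- a..0}"
      using up[of _ 0] down[of _ 0] by force
    then show ?thesis
      using zeros_witness_root_poly_bounded less.prems(1) by blast
  qed
qed

theorem theorem1p7:
  fixes a :: real and P :: "real poly"
  assumes "a > 0"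
    and "degree P > 0"
    and "only_real_zeros P"
    and "\<And>x. x \<in> ({smallest_zero P .. -a} \<inter> {- a - real k | k :: nat. True})
              \<union> ({0 .. largest_zero P} \<inter> \<int>) \<Longrightarrow> poly P x = 0"
  shows "complex_zeros (L_op a P) \<subseteq> complex_of_real ` {-1..0}"
proof -
  have L: "L_op a = basis_map_witness a"
    using is_basis_map_unique is_basis_map_L_op is_basis_map_witness assms(1) by blast
  have "P \<noteq> 0"
    using assms(2) by auto
  then obtain c rs where c: "c \<noteq> 0" and P: "P = smult c (root_poly rs)"
    using only_real_zeros_imp_root_poly assms(3) unfolding only_real_zeros_def by blast
  have zeros: "poly P x = 0 \<longleftrightarrow> x \<in> set rs" for x
    using c by (simp add: P poly_root_poly_eq_0_iff)
  have range: "smallest_zero P \<le> r" "r \<le> largest_zero P" if "r \<in> set rs" for r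
    using that by (simp_all add: smallest_zero_def largest_zero_def zeros)
  have "complex_zeros (basis_map_witness a (root_poly rs)) \<subseteq> complex_of_real ` {-1..0}"
  proof (rule zeros_witness_root_poly)
    fix r k assume "r \<in> set rs" "real k \<le> r"
    then show "real k \<in> set rs"
      using assms(4)[of "real k"] range(2)[of r] by (simp add: zeros)
  next
    fix r k assume "r \<in> set rs" "r \<le> - a - real k"
    then show "- a - real k \<in> set rs"
      using assms(4)[of "- a - real k"] range(1)[of r] by (auto simp: zeros)
  qed (use assms in simp)
  then show ?thesis
    using c by (simp add: L P witness_smult complex_zeros_smult)
qed

end
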